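(* Let $r$ and $\gamma$ be positive integers and let $G$ be a prior probability distribution on $(0,1)$ with finite first moment. Suppose that $m_n(z|y)$ is a consistent estimator for the marginal $m_G(z|y)=\int_0^1 p(z|\theta,y)\,dG(\theta)$, for $(z,y)=(x,r)$ and $(z,y)=(x+\gamma,r+\gamma)$, $x=r,r+1,\ldots$. For integers $x\ge r$ let $$\tau_n(x)=\frac{r+\gamma}{r}\left(\frac{x+\gamma}{x}\right)^{x-r-1}\frac{m_n(x|r)}{m_n(x+\gamma|r+\gamma)},$$ $$\theta_n(x)=\begin{cases}\gamma^{-1}\ln\tau_n(x), & \text{if } \tau_n(x)\in(1,e^{\gamma}),\\[2pt] \dfrac{x-r}{x}, & \text{if } \tau_n(x)\notin(1,e^{\gamma}).\end{cases}$$ Then the empirical Bayes estimator $\theta_n$ is asymptotically optimal under LINEX loss $L_\gamma$, i.e. $$\lim_{n\to\infty}R(G,\theta_n)=R(G,\theta_G),$$ where $\theta_G$ is the Bayes estimator and $R(G,\cdot)$ the Bayes risk, as defined in the context.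
   Context: Borel-Tanner distribution: for $0<\theta<1$ and a positive integer $r$, $p(x|\theta,r)=a_r(x)\theta^{x-r}e^{-\theta x}$ for $x=r,r+1,\ldots$, where $a_r(x)=r x^{x-r-1}/(x-r)!$. LINEX loss: $L_\gamma(\hat\theta,\theta)=e^{\gamma(\hat\theta-\theta)}-\gamma(\hat\theta-\theta)-1$. Prior and Bayes estimator: $\theta$ has distribution $G$ on $(0,1)$ and, conditionally on $\theta$, $X$ has probability mass function $p(\cdot|\theta,r)$. The Bayes estimator $\theta_G(x)$ is the minimizer over $d\in\mathbb{R}$ of the posterior expected loss $E[L_\gamma(d,\theta)\mid X=x]$; equivalently $\theta_G(x)=-\gamma^{-1}\ln E[e^{-\gamma\theta}\mid X=x]$. Empirical Bayes setting: $\theta_1,\theta_2,\ldots$ are independent unobserved realizations from $G$. The past data $\underline{X}_n$ consist of $n$ independent observations, the $i$-th one generated from Borel-Tanner distribution(s) with parameter $\theta_i$ (for instance $X_i$ with probability mass function $p(\cdot|\theta_i,r)$, or a pair of conditionally independent variables $X_i(r),X_i(\gamma)$ with probability mass functions $p(\cdot|\theta_i,r)$ and $p(\cdot|\theta_i,\gamma)$). The past data are independent of the present pair $(X,\theta)=(X_{n+1},\theta_{n+1})$. For each $z,y$ the estimator $m_n(z|y)\ge 0$ is a (measurable) function of the past data $\underline{X}_n$; it is consistent if $m_n(z|y)\to m_G(z|y)$ in probability as $n\to\infty$. Bayes risk: for a (nonrandom) estimator $\hat\theta=\hat\theta(x)$, $R(G,\hat\theta)=\sum_{x=r}^\infty\int_0^1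 L_\gamma(\hat\theta(x),\theta)\,p(x|\theta,r)\,dG(\theta)$. For the data-dependent estimator $\theta_n$, let $R(G,\theta_n|\underline{X}_n)$ be this quantity computed with $\hat\theta=\theta_n$ for given past data $\underline{X}_n$, and $R(G,\theta_n)=E_n\{R(G,\theta_n|\underline{X}_n)\}$, where $E_n$ is expectation with respect to $\underline{X}_n$. Convention: if $m_n(x+\gamma|r+\gamma)=0$, then $\tau_n(x)$ is regarded as not belonging to $(1,e^\gamma)$, so that $\theta_n(x)=(x-r)/x$. *)

theory Defs
  imports "HOL-Probability.Probability"
begin

text \<open>
  The Borel--Tanner probability mass function \<open>p(x | \<theta>, r)\<close>. The exponent \<open>x - r - 1\<close> is an
  integer, equal to \<open>-1\<close> at \<open>x = r\<close>.
\<close>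

definition bt_coeff :: "nat \<Rightarrow> nat \<Rightarrow> real" where
  "bt_coeff r x = real r * real x powi (int x - int r - 1) / fact (x - r)"

definition bt_pmf :: "nat \<Rightarrow> real \<Rightarrow> nat \<Rightarrow> real" where
  "bt_pmf x \<theta> r =
     (if r \<le> x then bt_coeff r x * \<theta> ^ (x - r) * exp (- (\<theta> * real x)) else 0)"

definition bt_marginal :: "real measure \<Rightarrow> nat \<Rightarrow> nat \<Rightarrow> real" where
  "bt_marginal G z y = (\<integral>\<theta>. bt_pmf z \<theta> y \<partial>G)"

text \<open>
  Joint mass function of conditionally independent Borel--Tanner variables with common
  parameter \<open>\<theta>\<close> and integer parameters listed in \<open>ks\<close>.
\<close>

definition bt_pmf_list :: "nat list \<Rightarrow> real \<Rightarrow> nat list \<Rightarrow> real" where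
  "bt_pmf_list ks \<theta> xs =
     (if length xs = length ks then \<Prod>j<length ks. bt_pmf (xs ! j) \<theta> (ks ! j) else 0)"

definition linex :: "real \<Rightarrow> real \<Rightarrow> real \<Rightarrow> real" where
  "linex \<gamma> d \<theta> = exp (\<gamma> * (d - \<theta>)) - \<gamma> * (d - \<theta>) - 1"

text \<open>
  Joint law of a parameter with distribution \<open>G\<close> and a discrete observation which, given the
  parameter \<open>\<theta>\<close>, has probability mass function \<open>q \<theta>\<close>.
\<close>

definition joint_law :: "real measure \<Rightarrow> (real \<Rightarrow> 'a \<Rightarrow> real) \<Rightarrow> (real \<times> 'a) measure" where
  "joint_law G q = density (G \<Otimes>\<^sub>M count_space UNIV) (\<lambda>(\<theta>, x). ennreal (q \<theta> x))"

text \<open>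
  \<open>E[L\<^sub>\<gamma>(d, \<theta>) | X = x]\<close>: the law of \<open>(\<theta>, X)\<close> is conditioned on the event \<open>X = x\<close>, which has
  positive probability for \<open>x \<ge> r\<close>.
\<close>

definition posterior_loss :: "real measure \<Rightarrow> nat \<Rightarrow> nat \<Rightarrow> nat \<Rightarrow> real \<Rightarrow> real" where
  "posterior_loss G r \<gamma> x d =
     (\<integral>(\<theta>, _). linex \<gamma> d \<theta>
        \<partial>uniform_measure (joint_law G (\<lambda>\<theta> x. bt_pmf x \<theta> r)) (UNIV \<times> {x}))"

definition bayes_estimator :: "real measure \<Rightarrow> nat \<Rightarrow> nat \<Rightarrow> nat \<Rightarrow> real" where
  "bayes_estimator G r \<gamma> x = (ARG_MIN (posterior_loss G r \<gamma> x) d. True)"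

text \<open>
  The LINEX loss and, for \<open>\<theta>\<close> in \<open>(0, 1)\<close>, the mass function are nonnegative, so risks are taken
  in \<open>[0, \<infinity>]\<close>, where the integrals and the series always make sense.
\<close>

definition bayes_risk :: "real measure \<Rightarrow> nat \<Rightarrow> nat \<Rightarrow> (nat \<Rightarrow> real) \<Rightarrow> ennreal" where
  "bayes_risk G r \<gamma> \<delta> =
     (\<Sum>k. \<integral>\<^sup>+\<theta>. ennreal (linex \<gamma> (\<delta> (r + k)) \<theta> * bt_pmf (r + k) \<theta> r) \<partial>G)"

text \<open>
  The unobserved parameters \<open>\<Theta> i\<close> are drawn from \<open>G\<close>. Given \<open>\<Theta> i\<close>, the observation \<open>X i\<close> is
  a list of conditionally independent Borel--Tanner variables with integer parameters \<open>ks i\<close>;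
  for instance \<open>ks i = [r]\<close> is a single variable, and \<open>ks i = [r, \<gamma>]\<close> a pair.
\<close>

locale bt_sample = prob_space M
  for M :: "'w measure" and G :: "real measure" and ks :: "nat \<Rightarrow> nat list"
    and \<Theta> :: "nat \<Rightarrow> 'w \<Rightarrow> real" and X :: "nat \<Rightarrow> 'w \<Rightarrow> nat list" +
  assumes design: "\<And>i. ks i \<noteq> []" "\<And>i k. k \<in> set (ks i) \<Longrightarrow> k > 0"
    and parameter: "\<And>i. distr M borel (\<Theta> i) = G"
    and observation:
      "\<And>i. distr M (borel \<Otimes>\<^sub>M count_space UNIV) (\<lambda>\<omega>. (\<Theta> i \<omega>, X i \<omega>))
            = joint_law G (bt_pmf_list (ks i))"
    and independent:
      "indep_vars (\<lambda>_. borel \<Otimes>\<^sub>M count_space UNIV) (\<lambda>i \<omega>. (\<Theta> i \<omega>, X i \<omega>)) UNIV"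

definition past_data :: "(nat \<Rightarrow> 'w \<Rightarrow> nat list) \<Rightarrow> nat \<Rightarrow> 'w \<Rightarrow> nat list list" where
  "past_data X n \<omega> = map (\<lambda>i. X i \<omega>) [0..<n]"

definition tendsto_in_probability ::
  "'w measure \<Rightarrow> (nat \<Rightarrow> 'w \<Rightarrow> real) \<Rightarrow> real \<Rightarrow> bool" where
  "tendsto_in_probability M Y c \<longleftrightarrow>
     (\<forall>\<epsilon>>0. (\<lambda>n. measure M {\<omega> \<in> space M. \<bar>Y n \<omega> - c\<bar> > \<epsilon>}) \<longlonglongrightarrow> 0)"

text \<open>
  An estimator of the marginals is a function of the sample size, the past data and \<open>z\<close>, \<open>y\<close>. It is
  automatically measurable in the past data, which take values in a countable discrete space.
\<close>

type_synonym marginal_estimator = "nat \<Rightarrow> nat list list \<Rightarrow> nat \<Rightarrow> nat \<Rightarrow> real"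

definition consistent_at ::
  "'w measure \<Rightarrow> (nat \<Rightarrow> 'w \<Rightarrow> nat list) \<Rightarrow> real measure \<Rightarrow> marginal_estimator
     \<Rightarrow> nat \<Rightarrow> nat \<Rightarrow> bool" where
  "consistent_at M X G m z y \<longleftrightarrow>
     tendsto_in_probability M (\<lambda>n \<omega>. m n (past_data X n \<omega>) z y) (bt_marginal G z y)"

text \<open>
  If the denominator vanishes then \<open>eb_ratio\<close> is \<open>0\<close>, hence outside \<open>(1, e\<^sup>\<gamma>)\<close>, and \<open>eb_estimator\<close>
  takes the value \<open>(x - r) / x\<close>.
\<close>

definition eb_ratio ::
  "marginal_estimator \<Rightarrow> nat \<Rightarrow> nat \<Rightarrow> nat \<Rightarrow> nat list list \<Rightarrow> nat \<Rightarrow> real" where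
  "eb_ratio m r \<gamma> n data x =
     (real r + real \<gamma>) / real r
       * ((real x + real \<gamma>) / real x) powi (int x - int r - 1)
       * (m n data x r / m n data (x + \<gamma>) (r + \<gamma>))"

definition eb_estimator ::
  "marginal_estimator \<Rightarrow> nat \<Rightarrow> nat \<Rightarrow> nat \<Rightarrow> nat list list \<Rightarrow> nat \<Rightarrow> real" where
  "eb_estimator m r \<gamma> n data x =
     (let \<tau> = eb_ratio m r \<gamma> n data x in
      if \<tau> \<in> {1<..<exp (real \<gamma>)} then ln \<tau> / real \<gamma> else (real x - real r) / real x)"

definition eb_risk ::
  "'w measure \<Rightarrow> (nat \<Rightarrow> 'w \<Rightarrow> nat list) \<Rightarrow> real measure \<Rightarrow> nat \<Rightarrow> nat
     \<Rightarrow> (nat \<Rightarrow> nat list list \<Rightarrow> nat \<Rightarrow> real) \<Rightarrow> nat \<Rightarrow> ennreal" where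
  "eb_risk M X G r \<gamma> \<delta> n = (\<integral>\<^sup>+\<omega>. bayes_risk G r \<gamma> (\<delta> n (past_data X n \<omega>)) \<partial>M)"

end

(* For 0 < theta < 1 we have theta exp (- theta) <= exp (- 1), so p(r + k | theta, r) is at most
   a_r(r + k) exp (- k), which is summable in k. Multiplying p(x | theta, r) by exp (- gamma theta)
   gives a multiple of p(x + gamma | theta, r + gamma), so the Bayes estimator is ln tau / gamma with
   tau a known multiple of the ratio of the true marginals, and tau lies in (1, e^gamma). There the
   estimator is a continuous function of the two marginals, so for each x the conditional risk
   converges in probability to that of the Bayes estimator. As estimates stay in [0, 1] the risks
   are bounded, hence their expectations converge, and Tannery's theorem sums over x. *)

theory Submission
  imports Defs
begin

section \<open>Summability of the majorant of the mass function\<close>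

text \<open>The two sides agree at 1, and their difference has derivative (1 - 1/t)^2 / 2. At s = 1
  + 1/k this gives k ln (1 + 1/k) <= 1 - 1/(2k + 2), a gain over ln (1 + u) <= u that makes the
  telescoping below possible.\<close>

lemma ln_le_half_diff_inverse:
  fixes s :: real
  assumes "s \<ge> 1"
  shows "ln s \<le> (s - inverse s) / 2"
proof -
  let ?f = "\<lambda>t::real. (t - inverse t) / 2 - ln t"
  have "?f 1 \<le> ?f s"
  proof (rule DERIV_nonneg_imp_nondecreasing[OF assms])
    fix t :: real assume "1 \<le> t"
    then have "(?f has_real_derivative (1 - inverse t)\<^sup>2 / 2) (at t)"
      by (auto intro!: derivative_eq_intros simp: field_simps power2_eq_square)
    then show "\<exists>y. (?f has_real_derivative y) (at t) \<and> 0 \<le> y"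
      by (intro exI[of _ "(1 - inverse t)\<^sup>2 / 2"]) simp
  qed
  then show ?thesis by simp
qed

text \<open>
  The inequality \<open>b (k + 1) / b k \<le> 1 - 1 / (2 k + 3)\<close> makes the sum of \<open>b k / (2 k + 3)\<close>
  telescope, so that Stirling's formula is not needed.
\<close>

lemma power_self_step:
  fixes k :: nat
  defines "b \<equiv> \<lambda>k::nat. real k ^ k * exp (- real k) / fact k"
  shows "b k / (2 * real k + 3) \<le> b k - b (Suc k)"
proof -
  have "(1 + 1 / real k) ^ k \<le> exp 1 * (1 - 1 / (2 * real k + 3))" if "k > 0"
  proof -
    let ?u = "1 / real k"
    have "real k * ln (1 + ?u) \<le> real k * ((1 + ?u - inverse (1 + ?u)) / 2)"
      by (intro mult_left_mono ln_le_half_diff_inverse) auto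
    also have "\<dots> = 1 - 1 / (2 * real k + 2)"
      using that by (simp add: divide_simps) (simp add: algebra_simps)
    finally have "exp (real k * ln (1 + ?u)) \<le> exp (1 - 1 / (2 * real k + 2))"
      by simp
    moreover have "exp (real k * ln (1 + ?u)) = (1 + ?u) ^ k"
      by (simp add: exp_of_nat_mult add_pos_nonneg)
    moreover have "exp (1 - 1 / (2 * real k + 2)) = exp 1 * inverse (exp (1 / (2 * real k + 2)))"
      by (simp only: exp_diff divide_inverse)
    \<comment> \<open>With exp v >= 1 + v at v = 1/(2k + 2), the factor exp (-v) is at most (2k +
      2)/(2k + 3); this is the origin of the constant 2k + 3.\<close>
    moreover have "inverse (exp (1 / (2 * real k + 2))) \<le> inverse (1 + 1 / (2 * real k + 2))"
      by (intro le_imp_inverse_le) (auto intro: add_pos_nonneg)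
    moreover have "inverse (1 + 1 / (2 * real k + 2)) = 1 - 1 / (2 * real k + 3)"
      by (simp add: field_simps)
    ultimately show ?thesis
      by (smt (verit) exp_gt_zero mult_left_mono)
  qed
  moreover have "b (Suc k) = b k * ((1 + 1 / real k) ^ k * exp (- 1))" if "k > 0"
  proof -
    have "real k ^ k * (1 + 1 / real k) ^ k = real (Suc k) ^ k"
      using that by (simp flip: power_mult_distrib add: field_simps)
    moreover have "b (Suc k) = real (Suc k) ^ k * exp (- 1) * exp (- real k) / fact k"
      unfolding b_def by (simp add: exp_diff exp_minus divide_simps)
    ultimately show ?thesis
      by (simp add: b_def)
  qed
  moreover have "b k \<ge> 0" by (simp add: b_def)
  \<comment> \<open>The quotient formula divides by k, so k = 0 is separate: as 0^0 = 1, the claim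
    reads 1/3 <= 1 - exp (-1), for which exp 1 >= 2 suffices.\<close>
  moreover have ?thesis if "k = 0"
  proof -
    have "(2::real) \<le> exp 1" using exp_ge_add_one_self[of 1] by simp
    then show ?thesis using that by (simp add: b_def exp_minus field_simps)
  qed
  moreover have "b k * (exp 1 * (1 - 1 / (2 * real k + 3)) * exp (-1)) = b k - b k / (2 * real k + 3)"
    by (simp add: exp_minus algebra_simps)
  ultimately show ?thesis
    by (smt (verit, best) exp_ge_zero mult_left_mono mult_right_mono neq0_conv)
qed

lemma summable_power_self:
  "summable (\<lambda>k::nat. real k ^ k * exp (- real k) / fact k / (2 * real k + 3))"
proof (rule summableI_nonneg_bounded)
  let ?b = "\<lambda>k::nat. real k ^ k * exp (- real k) / fact k"
  fix n
  have "(\<Sum>k<n. ?b k / (2 * real k + 3)) \<le> (\<Sum>k<n. ?b k - ?b (Suc k))"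
    by (intro sum_mono power_self_step)
  also have "\<dots> = ?b 0 - ?b n" by (rule sum_lessThan_telescope')
  also have "\<dots> \<le> 1" by simp
  finally show "(\<Sum>k<n. ?b k / (2 * real k + 3)) \<le> 1" .
qed simp

text \<open>This is the mass function at \<theta> = 1 without the factor exp (-r): \<theta> exp
  (-\<theta>) is largest at \<theta> = 1, which makes the bound uniform in \<theta>.\<close>

definition bt_bound :: "nat \<Rightarrow> nat \<Rightarrow> real" where
  "bt_bound r k = bt_coeff r (r + k) * exp (- real k)"

lemma bt_coeff_pos: "0 < r \<Longrightarrow> r \<le> x \<Longrightarrow> 0 < bt_coeff r x"
  by (simp add: bt_coeff_def)

lemma bt_coeff_add:
  assumes "r > 0"
  shows "bt_coeff r (r + k) = real r * real (r + k) ^ k / (real (r + k) * fact k)"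
proof -
  have "real (r + k) powi (int (r + k) - int r - 1) = real (r + k) ^ k / real (r + k)"
    using assms by (simp add: power_int_diff)
  then show ?thesis by (simp add: bt_coeff_def)
qed

text \<open>Since (1 + r/k)^k <= e^r, the power (r + k)^k is at most e^r k^k. Since r >= 1, also 2k
  + 3 <= 3 (r + k), which matches the denominators and leaves the constant 3 r e^r.\<close>

lemma summable_bt_bound:
  assumes "r > 0"
  shows "summable (bt_bound r)"
proof (rule summable_comparison_test'[where N = 0])
  show "summable (\<lambda>k. 3 * real r * exp (real r) *
    (real k ^ k * exp (- real k) / fact k / (2 * real k + 3)))"
    by (intro summable_mult summable_power_self)
  fix k :: nat
  have "real (r + k) ^ k \<le> exp (real r) * real k ^ k"
  proof (cases "k = 0")
    case False
    have "real (r + k) ^ k = (1 + real r / real k) ^ k * real k ^ k"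
      using False by (simp flip: power_mult_distrib add: field_simps)
    also have "\<dots> \<le> exp (real r) * real k ^ k"
      using False exp_ge_one_plus_x_over_n_power_n[of k "real r"]
      by (intro mult_right_mono) auto
    finally show ?thesis .
  qed simp
  moreover have "2 * real k + 3 \<le> 3 * real (r + k)"
    using assms by simp
  ultimately have "real r * real (r + k) ^ k / (real (r + k) * fact k)
      \<le> real r * (exp (real r) * real k ^ k) / ((2 * real k + 3) / 3 * fact k)"
    using assms by (intro frac_le mult_left_mono mult_right_mono mult_nonneg_nonneg) auto
  then have "bt_coeff r (r + k) * exp (- real k)
    \<le> real r * (exp (real r) * real k ^ k) / ((2 * real k + 3) / 3 * fact k) * exp (- real k)"
    unfolding bt_coeff_add[OF assms] by (intro mult_right_mono) auto
  also have "\<dots> = 3 * real r * exp (real r) *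
    (real k ^ k * exp (- real k) / fact k / (2 * real k + 3))"
    by (simp add: mult_ac)
  finally show "norm (bt_bound r k) \<le> 3 * real r * exp (real r) *
    (real k ^ k * exp (- real k) / fact k / (2 * real k + 3))"
    using bt_coeff_pos[of r "r + k"] assms by (simp add: bt_bound_def)
qed

section \<open>Bounds and shift identities for the mass function\<close>

lemma bt_pmf_pos: "0 < r \<Longrightarrow> r \<le> x \<Longrightarrow> 0 < \<theta> \<Longrightarrow> 0 < bt_pmf x \<theta> r"
  by (simp add: bt_pmf_def bt_coeff_pos)

text \<open>Of exp (-\<theta> (r + k)), the part exp (-\<theta> k) is paired with \<theta>^k, and
  the remaining exp (-\<theta> r) is at most 1.\<close>

lemma bt_pmf_le_bound:
  assumes "r > 0" "\<theta> > 0"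
  shows "bt_pmf (r + k) \<theta> r \<le> bt_bound r k"
proof -
  have "\<theta> * exp (- \<theta>) \<le> exp (\<theta> - 1) * exp (- \<theta>)"
    using exp_ge_add_one_self[of "\<theta> - 1"] by (intro mult_right_mono) auto
  also have "\<dots> = exp (- 1)" by (simp flip: exp_add)
  finally have "(\<theta> * exp (- \<theta>)) ^ k \<le> exp (- 1) ^ k"
    using assms by (intro power_mono) auto
  moreover have "exp (- (\<theta> * real r)) \<le> 1" using assms by simp
  ultimately have "(\<theta> * exp (- \<theta>)) ^ k * exp (- (\<theta> * real r)) \<le> exp (- 1) ^ k * 1"
    using assms by (intro mult_mono) auto
  moreover have "exp (- (\<theta> * real (r + k))) = exp (- \<theta>) ^ k * exp (- (\<theta> * real r))"
    by (simp flip: exp_of_nat_mult exp_add add: algebra_simps)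
  ultimately have "\<theta> ^ k * exp (- (\<theta> * real (r + k))) \<le> exp (- real k)"
    by (simp add: power_mult_distrib mult_ac flip: exp_of_nat_mult)
  then show ?thesis
    using bt_coeff_pos[of r "r + k"] assms
    by (simp add: bt_pmf_def bt_bound_def mult.assoc)
qed

lemma measurable_bt_pmf [measurable]: "(\<lambda>\<theta>. bt_pmf x \<theta> r) \<in> borel_measurable borel"
  unfolding bt_pmf_def by measurable

lemma measurable_linex [measurable]: "(\<lambda>\<theta>. linex \<gamma> d \<theta>) \<in> borel_measurable borel"
  unfolding linex_def by measurable

lemma linex_nonneg: "0 \<le> linex \<gamma> d \<theta>"
  using exp_ge_add_one_self[of "\<gamma> * (d - \<theta>)"] unfolding linex_def by linarith

text \<open>Raising x and r together by \<gamma> keeps the exponent x - r of \<theta> and multiplies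
  exp (-\<theta> x) by exp (-\<gamma> \<theta>); only the coefficients have to be exchanged.\<close>

lemma exp_mult_bt_pmf:
  assumes "r > 0" "r \<le> x"
  shows "bt_coeff (r + \<gamma>) (x + \<gamma>) * (exp (- (real \<gamma> * \<theta>)) * bt_pmf x \<theta> r)
       = bt_coeff r x * bt_pmf (x + \<gamma>) \<theta> (r + \<gamma>)"
  using assms by (simp add: bt_pmf_def algebra_simps flip: exp_add)

text \<open>Both coefficients share the factorial of x - r and the exponent x - r - 1, so only their
  bases and leading factors differ. The quotient is the known factor in
  \<open>eb_ratio\<close>.\<close>

lemma bt_coeff_ratio:
  assumes "r > 0" "r \<le> x"
  shows "bt_coeff (r + \<gamma>) (x + \<gamma>) = bt_coeff r x *
    ((real r + real \<gamma>) / real r * ((real x + real \<gamma>) / real x) powi (int x - int r - 1))"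
  using assms by (simp add: bt_coeff_def power_int_divide_distrib)

section \<open>Convergence in probability\<close>

text \<open>Bounded convergence: the deviation from c is at most e/2 off the event
  \<open>E n\<close> and at most C + |c| on it, and the probability of \<open>E n\<close> tends to
  0.\<close>

lemma (in prob_space) expectation_tendsto_if_tendsto_in_probability:
  assumes meas: "\<And>n. random_variable borel (Y n)"
    and bound: "\<And>n \<omega>. \<omega> \<in> space M \<Longrightarrow> \<bar>Y n \<omega>\<bar> \<le> C"
    and conv: "tendsto_in_probability M Y c"
  shows "(\<lambda>n. expectation (Y n)) \<longlonglongrightarrow> c"
proof (rule tendstoI)
  fix e :: real assume "e > 0"
  define E where "E = (\<lambda>n. {\<omega> \<in> space M. \<bar>Y n \<omega> - c\<bar> > e / 2})"
  note meas [measurable]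
  have E [measurable]: "E n \<in> events" for n
    unfolding E_def by measurable
  have int: "integrable M (Y n)" for n
    by (rule integrable_const_bound[of _ C]) (use bound in auto)
  have ind: "integrable M (\<lambda>\<omega>. (C + \<bar>c\<bar>) * indicator (E n) \<omega>)" for n
    by (rule integrable_const_bound[of _ "\<bar>C + \<bar>c\<bar>\<bar>"]) (auto simp: indicator_def)
  have le: "\<bar>expectation (Y n) - c\<bar> \<le> e / 2 + (C + \<bar>c\<bar>) * prob (E n)" for n
  proof -
    have "expectation (Y n) - c = expectation (\<lambda>\<omega>. Y n \<omega> - c)"
      using int by (simp add: prob_space)
    also have "\<bar>\<dots>\<bar> \<le> expectation (\<lambda>\<omega>. \<bar>Y n \<omega> - c\<bar>)"
      by (rule integral_abs_bound)
    also have "\<dots> \<le> expectation (\<lambda>\<omega>. e / 2 + (C + \<bar>c\<bar>) * indicator (E n) \<omega>)"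
    proof (rule integral_mono)
      fix \<omega> assume "\<omega> \<in> space M"
      then show "\<bar>Y n \<omega> - c\<bar> \<le> e / 2 + (C + \<bar>c\<bar>) * indicator (E n) \<omega>"
        using bound[of \<omega> n] \<open>e > 0\<close> by (auto simp: indicator_def E_def)
    qed (use int ind in auto)
    also have "\<dots> = e / 2 + (C + \<bar>c\<bar>) * prob (E n)"
      by (subst Bochner_Integration.integral_add[OF integrable_const ind]) (simp add: prob_space)
    finally show ?thesis .
  qed
  have "(\<lambda>n. (C + \<bar>c\<bar>) * prob (E n)) \<longlonglongrightarrow> (C + \<bar>c\<bar>) * 0"
    unfolding E_def using \<open>e > 0\<close> conv[unfolded tendsto_in_probability_def, rule_format, of "e / 2"]
    by (intro tendsto_mult_left) simp
  then have "\<forall>\<^sub>F n in sequentially. (C + \<bar>c\<bar>) * prob (E n) < e / 2"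
    using \<open>e > 0\<close> by (intro order_tendstoD) auto
  then show "\<forall>\<^sub>F n in sequentially. dist (expectation (Y n)) c < e"
  proof eventually_elim
    case (elim n)
    then show ?case
      using le[of n] by (simp add: dist_real_def)
  qed
qed

text \<open>Continuous mapping at a single point, as required for an estimator that may jump
  elsewhere.\<close>

lemma (in prob_space) tendsto_in_probability_isCont_pair:
  fixes h :: "real \<times> real \<Rightarrow> real"
  assumes [measurable]: "\<And>n. random_variable borel (A n)" "\<And>n. random_variable borel (B n)"
    and A: "tendsto_in_probability M A a" and B: "tendsto_in_probability M B b"
    and h: "isCont h (a, b)"
  shows "tendsto_in_probability M (\<lambda>n \<omega>. h (A n \<omega>, B n \<omega>)) (h (a, b))"
  unfolding tendsto_in_probability_def
proof (intro allI impI)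
  fix e :: real assume "e > 0"
  then obtain \<delta> where \<delta>: "\<delta> > 0" "\<And>z. dist z (a, b) < \<delta> \<Longrightarrow> dist (h z) (h (a, b)) < e"
    using h unfolding continuous_at_eps_delta by blast
  let ?E = "\<lambda>n. {\<omega> \<in> space M. \<bar>h (A n \<omega>, B n \<omega>) - h (a, b)\<bar> > e}"
  \<comment> \<open>Two deviations of at most \<delta>/3 keep the pair within 2\<delta>/3 < \<delta>
    of the limit.\<close>
  let ?EA = "\<lambda>n. {\<omega> \<in> space M. \<bar>A n \<omega> - a\<bar> > \<delta> / 3}"
  let ?EB = "\<lambda>n. {\<omega> \<in> space M. \<bar>B n \<omega> - b\<bar> > \<delta> / 3}"
  have sub: "?E n \<subseteq> ?EA n \<union> ?EB n" for n
  proof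
    fix \<omega> assume "\<omega> \<in> ?E n"
    then have "\<omega> \<in> space M" "\<not> dist (A n \<omega>, B n \<omega>) (a, b) < \<delta>"
      using \<delta>(2)[of "(A n \<omega>, B n \<omega>)"] by (auto simp: dist_real_def)
    moreover have "dist (A n \<omega>, B n \<omega>) (a, b) \<le> \<bar>A n \<omega> - a\<bar> + \<bar>B n \<omega> - b\<bar>"
      using sqrt_sum_squares_le_sum_abs[of "A n \<omega> - a" "B n \<omega> - b"]
      by (simp add: dist_prod_def dist_real_def)
    ultimately show "\<omega> \<in> ?EA n \<union> ?EB n"
      using \<delta>(1) by auto
  qed
  have ev: "?EA n \<in> events" "?EB n \<in> events" for n by measurable
  have le: "prob (?E n) \<le> prob (?EA n) + prob (?EB n)" for n
  proof -
    \<comment> \<open>For a general \<open>h\<close> the set \<open>?E n\<close> may fail to be an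
      event; monotonicity asks for measurability of the larger set only.\<close>
    have "prob (?E n) \<le> prob (?EA n \<union> ?EB n)"
      using sub ev by (intro finite_measure_mono) auto
    also have "\<dots> \<le> prob (?EA n) + prob (?EB n)"
      using ev by (intro measure_Un_le)
    finally show ?thesis .
  qed
  have "\<delta> / 3 > 0" using \<delta>(1) by simp
  then have "(\<lambda>n. prob (?EA n) + prob (?EB n)) \<longlonglongrightarrow> 0 + 0"
    using A B unfolding tendsto_in_probability_def by (intro tendsto_add) blast+
  then have lim: "(\<lambda>n. prob (?EA n) + prob (?EB n)) \<longlonglongrightarrow> 0"
    by (simp only: add_0)
  show "(\<lambda>n. prob (?E n)) \<longlonglongrightarrow> 0"
  proof (rule Lim_null_comparison[OF always_eventually lim], rule allI)
    show "norm (prob (?E n)) \<le> prob (?EA n) + prob (?EB n)" for n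
      unfolding real_norm_def abs_of_nonneg[OF measure_nonneg] by (rule le)
  qed
qed

section \<open>Laws of the past data and of the present observation\<close>

text \<open>The first n observations take countably many values, and once they are fixed the
  extended list is a function of \<open>X n\<close> alone.\<close>

lemma (in bt_sample) measurable_past_data:
  "past_data X n \<in> measurable M (count_space UNIV)"
proof (induction n)
  case (Suc n)
  have "(\<lambda>\<omega>. (\<Theta> n \<omega>, X n \<omega>)) \<in> measurable M (borel \<Otimes>\<^sub>M count_space UNIV)"
    using independent by (auto simp: indep_vars_def)
  from measurable_compose[OF this measurable_snd]
  have X: "X n \<in> measurable M (count_space UNIV)" by simp
  have "(\<lambda>\<omega>. past_data X n \<omega> @ [X n \<omega>]) \<in> measurable M (count_space UNIV)"
    by (rule measurable_compose_countable[OF measurable_compose[OF X] Suc]) simp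
  then show ?case by (simp add: past_data_def[abs_def])
qed (simp add: past_data_def[abs_def])

text \<open>By Tonelli, the indicator reduces the inner sum over observations to one term. Taking
  \<open>h\<close> as 1 gives the probability of X = x, and taking it as the loss gives the
  numerator of the posterior loss.\<close>

lemma nn_integral_joint_law_observation:
  fixes q :: "real \<Rightarrow> nat \<Rightarrow> real"
  assumes [measurable]: "\<And>y. (\<lambda>\<theta>. q \<theta> y) \<in> borel_measurable G" "h \<in> borel_measurable G"
    and space: "space G = UNIV"
  shows "(\<integral>\<^sup>+z. h (fst z) * indicator (UNIV \<times> {x}) z \<partial>joint_law G q)
       = (\<integral>\<^sup>+\<theta>. h \<theta> * ennreal (q \<theta> x) \<partial>G)"
proof -
  interpret C: sigma_finite_measure "count_space (UNIV :: nat set)"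
    by (rule sigma_finite_measure_count_space)
  have q [measurable]: "(\<lambda>(\<theta>, y). ennreal (q \<theta> y)) \<in> borel_measurable (G \<Otimes>\<^sub>M count_space UNIV)"
    unfolding case_prod_unfold
    by (rule measurable_compose_countable[where f = "\<lambda>y z. ennreal (q (fst z) y)" and g = snd]) measurable
  have [measurable]: "UNIV \<times> {x} \<in> sets (G \<Otimes>\<^sub>M count_space UNIV)"
    using sets.top[of G] by (intro pair_measureI) (auto simp: space)
  have "(\<integral>\<^sup>+z. h (fst z) * indicator (UNIV \<times> {x}) z \<partial>joint_law G q)
      = (\<integral>\<^sup>+z. (case z of (\<theta>, y) \<Rightarrow> ennreal (q \<theta> y)) * (h (fst z) * indicator (UNIV \<times> {x}) z)
          \<partial>(G \<Otimes>\<^sub>M count_space UNIV))"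
    unfolding joint_law_def by (rule nn_integral_density) measurable
  also have "\<dots> = (\<integral>\<^sup>+\<theta>. \<integral>\<^sup>+y. ennreal (q \<theta> y) * (h \<theta> * indicator (UNIV \<times> {x}) (\<theta>, y))
      \<partial>count_space UNIV \<partial>G)"
    by (subst C.nn_integral_fst[symmetric]) simp_all
  also have "\<dots> = (\<integral>\<^sup>+\<theta>. \<integral>\<^sup>+y. (h \<theta> * ennreal (q \<theta> y)) * indicator {x} y \<partial>count_space UNIV \<partial>G)"
    by (intro nn_integral_cong) (auto simp: indicator_def mult_ac)
  also have "\<dots> = (\<integral>\<^sup>+\<theta>. h \<theta> * ennreal (q \<theta> x) \<partial>G)"
    by simp
  finally show ?thesis .
qed

section \<open>The Bayes estimator of a fixed prior\<close>

locale bt_prior = prob_space G for G :: "real measure" +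
  fixes r \<gamma> :: nat
  assumes r_pos: "r > 0" and \<gamma>_pos: "\<gamma> > 0"
    and sets_G [measurable_cong]: "sets G = sets borel"
    and parameter_in: "AE \<theta> in G. \<theta> \<in> {0<..<1}"
begin

lemma space_G: "space G = UNIV"
  using sets_eq_imp_space_eq[OF sets_G] by simp

lemma AE_parameter:
  "(\<And>\<theta>. 0 < \<theta> \<Longrightarrow> \<theta> < 1 \<Longrightarrow> P \<theta>) \<Longrightarrow> AE \<theta> in G. P \<theta>"
  using parameter_in by (rule eventually_mono) simp

text \<open>The product is almost everywhere bounded by \<open>C * bt_bound y (x - y)\<close>, and
  \<open>G\<close> is finite. It is applied to 1, \<theta>, exp (-\<gamma> \<theta>) and the
  loss.\<close>

lemma integrable_bt_pmf_mult:
  assumes [measurable]: "h \<in> borel_measurable borel"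
    and bound: "\<And>\<theta>. \<theta> \<in> {0<..<1} \<Longrightarrow> \<bar>h \<theta>\<bar> \<le> C" and y: "0 < y" "y \<le> x"
  shows "integrable G (\<lambda>\<theta>. h \<theta> * bt_pmf x \<theta> y)"
proof (rule integrable_const_bound)
  show "AE \<theta> in G. norm (h \<theta> * bt_pmf x \<theta> y) \<le> C * bt_bound y (x - y)"
    using parameter_in
  proof eventually_elim
    case (elim \<theta>)
    then show ?case
      using bound[OF elim] bt_pmf_pos[of y x \<theta>] bt_pmf_le_bound[of y \<theta> "x - y"] y
      by (auto simp: abs_mult intro!: mult_mono)
  qed
qed measurable

lemma integrable_bt_pmf: "0 < y \<Longrightarrow> y \<le> x \<Longrightarrow> integrable G (\<lambda>\<theta>. bt_pmf x \<theta> y)"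
  using integrable_bt_pmf_mult[of "\<lambda>_. 1" 1 y x] by simp

lemma bt_marginal_pos: "0 < y \<Longrightarrow> y \<le> x \<Longrightarrow> 0 < bt_marginal G x y"
  unfolding bt_marginal_def
  using integral_less_AE_space[of "\<lambda>_. 0" "\<lambda>\<theta>. bt_pmf x \<theta> y"]
  by (simp add: integrable_bt_pmf emeasure_space_1 bt_pmf_pos AE_parameter)

text \<open>Divided by \<open>bt_marginal G x r\<close>, this is the posterior expectation of exp
  (-\<gamma> \<theta>).\<close>

definition laplace_term :: "nat \<Rightarrow> real" where
  "laplace_term x = (\<integral>\<theta>. exp (- (real \<gamma> * \<theta>)) * bt_pmf x \<theta> r \<partial>G)"

lemma integrable_laplace_term:
  "r \<le> x \<Longrightarrow> integrable G (\<lambda>\<theta>. exp (- (real \<gamma> * \<theta>)) * bt_pmf x \<theta> r)"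
  by (rule integrable_bt_pmf_mult[where C = 1]) (auto simp: r_pos)

lemma laplace_term_eq_marginal:
  assumes "r \<le> x"
  shows "bt_coeff (r + \<gamma>) (x + \<gamma>) * laplace_term x
       = bt_coeff r x * bt_marginal G (x + \<gamma>) (r + \<gamma>)"
  using assms r_pos unfolding laplace_term_def bt_marginal_def
  by (simp flip: integral_mult_right_zero add: exp_mult_bt_pmf)

text \<open>For \<theta> in (0, 1), exp (-\<gamma> \<theta>) lies strictly between exp (-\<gamma>)
  and 1, and the mass function is positive. Strictness survives integration and places the true
  ratio in the open interval (1, e^\<gamma>).\<close>

lemma laplace_term_bounds:
  assumes "r \<le> x"
  shows "laplace_term x < bt_marginal G x r"
    and "exp (- real \<gamma>) * bt_marginal G x r < laplace_term x"
proof -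
  have *: "AE \<theta> in G. exp (- (real \<gamma> * \<theta>)) * bt_pmf x \<theta> r < bt_pmf x \<theta> r"
    "AE \<theta> in G. exp (- real \<gamma>) * bt_pmf x \<theta> r < exp (- (real \<gamma> * \<theta>)) * bt_pmf x \<theta> r"
    using \<gamma>_pos assms r_pos by (auto simp: bt_pmf_pos intro!: AE_parameter)
  show "laplace_term x < bt_marginal G x r"
    unfolding laplace_term_def bt_marginal_def using assms r_pos
    by (intro integral_less_AE_space integrable_laplace_term integrable_bt_pmf *)
      (auto simp: emeasure_space_1)
  have "(\<integral>\<theta>. exp (- real \<gamma>) * bt_pmf x \<theta> r \<partial>G) < laplace_term x"
    unfolding laplace_term_def using assms r_pos
    by (intro integral_less_AE_space integrable_laplace_term *)
      (auto simp: emeasure_space_1 integrable_bt_pmf)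
  then show "exp (- real \<gamma>) * bt_marginal G x r < laplace_term x"
    by (simp add: bt_marginal_def)
qed

lemma laplace_term_pos: "r \<le> x \<Longrightarrow> 0 < laplace_term x"
  using laplace_term_bounds(2)[of x] bt_marginal_pos[of r x] r_pos
  by (smt (verit) exp_gt_zero mult_pos_pos)

text \<open>The contribution of X = x to the Bayes risk when the estimate there is \<open>d\<close>,
  that is, the posterior loss before normalisation.\<close>

definition risk_term :: "nat \<Rightarrow> real \<Rightarrow> real" where
  "risk_term x d = (\<integral>\<theta>. linex \<gamma> d \<theta> * bt_pmf x \<theta> r \<partial>G)"

text \<open>The exponential and the linear part are bounded separately. Arbitrary real
  \<open>d\<close> matters for the minimisation; on [0, 1] the bound is at most exp \<gamma> +
  2\<gamma>.\<close>

lemma linex_bound: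
  assumes "\<theta> \<in> {0<..<1}"
  shows "linex (real \<gamma>) d \<theta> \<le> exp (real \<gamma> * \<bar>d\<bar>) + real \<gamma> * (\<bar>d\<bar> + 1)"
proof -
  have "real \<gamma> * (d - \<theta>) \<le> real \<gamma> * \<bar>d\<bar>" "real \<gamma> * (\<theta> - d) \<le> real \<gamma> * (\<bar>d\<bar> + 1)"
    using assms by (intro mult_left_mono; auto)+
  then have "exp (real \<gamma> * (d - \<theta>)) \<le> exp (real \<gamma> * \<bar>d\<bar>)"
    "- (real \<gamma> * (d - \<theta>)) \<le> real \<gamma> * (\<bar>d\<bar> + 1)"
    by (simp_all add: algebra_simps)
  then show ?thesis unfolding linex_def by linarith
qed

lemma integrable_risk_term:
  "r \<le> x \<Longrightarrow> integrable G (\<lambda>\<theta>. linex (real \<gamma>) d \<theta> * bt_pmf x \<theta> r)"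
  by (rule integrable_bt_pmf_mult[OF measurable_linex])
    (use linex_bound linex_nonneg in \<open>auto simp: r_pos\<close>)

lemma nn_integral_risk_term:
  "r \<le> x \<Longrightarrow> (\<integral>\<^sup>+\<theta>. ennreal (linex \<gamma> d \<theta> * bt_pmf x \<theta> r) \<partial>G) = ennreal (risk_term x d)"
  unfolding risk_term_def
  by (intro nn_integral_eq_integral integrable_risk_term AE_parameter)
    (auto simp: linex_nonneg less_imp_le bt_pmf_pos r_pos)

lemma risk_term_nonneg: "r \<le> x \<Longrightarrow> 0 \<le> risk_term x d"
  unfolding risk_term_def
  by (intro integral_nonneg_AE AE_parameter)
    (auto simp: linex_nonneg less_imp_le bt_pmf_pos r_pos)

lemma risk_term_le:
  assumes "d \<in> {0..1}"
  shows "risk_term (r + k) d \<le> (exp (real \<gamma>) + 2 * real \<gamma>) * bt_bound r k"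
proof -
  have "risk_term (r + k) d \<le> (\<integral>\<theta>. (exp (real \<gamma>) + 2 * real \<gamma>) * bt_bound r k \<partial>G)"
    unfolding risk_term_def
  proof (rule integral_mono_AE)
    show "AE \<theta> in G. linex \<gamma> d \<theta> * bt_pmf (r + k) \<theta> r
        \<le> (exp (real \<gamma>) + 2 * real \<gamma>) * bt_bound r k"
      using parameter_in
    proof eventually_elim
      case (elim \<theta>)
      have "real \<gamma> * \<bar>d\<bar> \<le> real \<gamma> * 1" "real \<gamma> * (\<bar>d\<bar> + 1) \<le> real \<gamma> * 2"
        using assms by (intro mult_left_mono; simp)+
      then have "linex \<gamma> d \<theta> \<le> exp (real \<gamma>) + 2 * real \<gamma>"
        using linex_bound[OF elim, of d] by (smt (verit) exp_le_cancel_iff)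
      then show ?case
        using elim bt_pmf_pos[of r "r + k" \<theta>] bt_pmf_le_bound[of r \<theta> k] r_pos
        by (intro mult_mono) auto
    qed
  qed (auto simp: integrable_risk_term)
  then show ?thesis by (simp add: prob_space)
qed

text \<open>Factoring exp (\<gamma> (d - \<theta>)) separates \<open>d\<close> from \<theta>, and
  the final bracket is constant in \<open>d\<close>. Both the minimiser and the continuity in
  \<open>d\<close> are read off from this form.\<close>

lemma risk_term_eq:
  assumes x: "r \<le> x"
  shows "risk_term x d = exp (real \<gamma> * d) * laplace_term x - real \<gamma> * d * bt_marginal G x r
    + (real \<gamma> * (\<integral>\<theta>. \<theta> * bt_pmf x \<theta> r \<partial>G) - bt_marginal G x r)"
proof -
  have [simp]: "integrable G (\<lambda>\<theta>. \<theta> * bt_pmf x \<theta> r)"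
    using x r_pos by (intro integrable_bt_pmf_mult[where C = 1]) auto
  have [simp]: "integrable G (\<lambda>\<theta>. bt_pmf x \<theta> r)"
    using x r_pos by (rule integrable_bt_pmf[rotated])
  have "risk_term x d = (\<integral>\<theta>. exp (real \<gamma> * d) * (exp (- (real \<gamma> * \<theta>)) * bt_pmf x \<theta> r)
      - real \<gamma> * d * bt_pmf x \<theta> r + (real \<gamma> * (\<theta> * bt_pmf x \<theta> r) - bt_pmf x \<theta> r) \<partial>G)"
    unfolding risk_term_def linex_def
    by (intro Bochner_Integration.integral_cong refl)
      (simp add: algebra_simps exp_diff exp_minus divide_simps)
  also have "\<dots> = exp (real \<gamma> * d) * laplace_term x - real \<gamma> * d * bt_marginal G x r
    + (real \<gamma> * (\<integral>\<theta>. \<theta> * bt_pmf x \<theta> r \<partial>G) - bt_marginal G x r)"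
    using integrable_laplace_term[OF x] by (simp add: laplace_term_def bt_marginal_def)
  finally show ?thesis .
qed

lemma posterior_loss_eq:
  assumes x: "r \<le> x"
  shows "posterior_loss G r \<gamma> x d = risk_term x d / bt_marginal G x r"
proof -
  let ?J = "joint_law G (\<lambda>\<theta> x. bt_pmf x \<theta> r)"
  let ?S = "UNIV \<times> {x}"
  have sets_J: "sets ?J = sets (borel \<Otimes>\<^sub>M count_space UNIV)"
    by (simp add: joint_law_def) (intro sets_pair_measure_cong sets_G refl)
  have S: "?S \<in> sets ?J"
    unfolding sets_J by (intro pair_measureI) auto
  have lm [measurable]: "(\<lambda>z. linex (real \<gamma>) d (fst z)) \<in> borel_measurable ?J"
    unfolding measurable_cong_sets[OF sets_J refl] by measurable
  have pmf: "(\<lambda>\<theta>. bt_pmf y \<theta> r) \<in> borel_measurable G" for y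
    by measurable
  note joint = nn_integral_joint_law_observation[of "\<lambda>\<theta> x. bt_pmf x \<theta> r", OF pmf _ space_G]
  have "emeasure ?J ?S = (\<integral>\<^sup>+z. 1 * indicator ?S z \<partial>?J)"
    using S by simp
  also have "\<dots> = (\<integral>\<^sup>+\<theta>. ennreal (bt_pmf x \<theta> r) \<partial>G)"
    by (subst joint[of "\<lambda>_. 1"]) auto
  also have "\<dots> = ennreal (bt_marginal G x r)"
    unfolding bt_marginal_def using r_pos x
    by (intro nn_integral_eq_integral integrable_bt_pmf AE_parameter)
      (auto simp: less_imp_le bt_pmf_pos)
  finally have mass: "emeasure ?J ?S = ennreal (bt_marginal G x r)" .
  have "(\<integral>\<^sup>+z. ennreal (linex \<gamma> d (fst z)) * indicator ?S z \<partial>?J)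
      = (\<integral>\<^sup>+\<theta>. ennreal (linex \<gamma> d \<theta>) * ennreal (bt_pmf x \<theta> r) \<partial>G)"
    by (rule joint) measurable
  also have "\<dots> = ennreal (risk_term x d)"
    using nn_integral_risk_term[OF x, of d] by (simp add: ennreal_mult' linex_nonneg)
  finally have num: "(\<integral>\<^sup>+z. ennreal (linex \<gamma> d (fst z)) * indicator ?S z \<partial>?J)
    = ennreal (risk_term x d)" .
  have "posterior_loss G r \<gamma> x d = (\<integral>z. linex \<gamma> d (fst z) \<partial>uniform_measure ?J ?S)"
    unfolding posterior_loss_def case_prod_unfold ..
  \<comment> \<open>The loss is nonnegative, so the integral can be computed in [0, \<infinity>],
    where conditioning is division by the mass of the event.\<close>
  also have "\<dots> = enn2real (\<integral>\<^sup>+z. ennreal (linex \<gamma> d (fst z)) \<partial>uniform_measure ?J ?S)"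
    using lm by (intro integral_eq_nn_integral) (auto simp: linex_nonneg)
  also have "\<dots> = enn2real (ennreal (risk_term x d) / ennreal (bt_marginal G x r))"
    using S by (subst nn_integral_uniform_measure) (auto simp: num mass)
  also have "\<dots> = risk_term x d / bt_marginal G x r"
    using risk_term_nonneg[OF x] bt_marginal_pos[OF r_pos x]
    by (simp add: divide_ennreal)
  finally show ?thesis .
qed

text \<open>At \<open>d0\<close> the derivative of \<open>risk_term_eq\<close> vanishes. The excess
  posterior loss over \<open>d0\<close> is exp t - 1 - t with t = \<gamma> (d - d0), positive unless
  t = 0.\<close>

lemma bayes_estimator_eq:
  assumes x: "r \<le> x"
  shows "bayes_estimator G r \<gamma> x = ln (bt_marginal G x r / laplace_term x) / real \<gamma>"
proof -
  let ?m = "bt_marginal G x r" and ?T = "laplace_term x"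
  define d0 where "d0 = ln (?m / ?T) / real \<gamma>"
  have pos: "?m > 0" "?T > 0"
    using bt_marginal_pos[OF r_pos x] laplace_term_pos[OF x] by auto
  have d0: "exp (real \<gamma> * d0) * ?T = ?m"
    using pos \<gamma>_pos by (simp add: d0_def)
  have diff: "posterior_loss G r \<gamma> x d - posterior_loss G r \<gamma> x d0
      = exp (real \<gamma> * (d - d0)) - 1 - real \<gamma> * (d - d0)" for d
  proof -
    have "exp (real \<gamma> * d) * ?T = exp (real \<gamma> * (d - d0)) * (exp (real \<gamma> * d0) * ?T)"
      by (simp add: right_diff_distrib flip: exp_add mult.assoc)
    then have "risk_term x d - risk_term x d0
        = (exp (real \<gamma> * (d - d0)) - 1 - real \<gamma> * (d - d0)) * ?m"
      unfolding risk_term_eq[OF x] d0 by (simp only:) (simp add: algebra_simps)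
    then show ?thesis
      using pos by (simp add: posterior_loss_eq[OF x] flip: diff_divide_distrib)
  qed
  have "posterior_loss G r \<gamma> x d0 < posterior_loss G r \<gamma> x d" if "d \<noteq> d0" for d
    using diff[of d] exp_minus_greater[of "- (real \<gamma> * (d - d0))"] that \<gamma>_pos by auto
  \<comment> \<open>\<open>ARG_MIN\<close> is a choice among minimisers, so its value is determined
    only through uniqueness.\<close>
  then have "is_arg_min (posterior_loss G r \<gamma> x) (\<lambda>_. True) d \<longleftrightarrow> d = d0" for d
    unfolding is_arg_min_def by (cases "d = d0") (blast dest: less_asym)+
  then show ?thesis
    by (simp add: bayes_estimator_def arg_min_def d0_def)
qed

end

section \<open>The empirical Bayes estimator as a function of two marginals\<close>

text \<open>Separating the ratio from the data presents the empirical and the Bayes estimator as one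
  function, evaluated at estimated and at true marginals. The fallback (x - r)/x is the maximum
  likelihood estimate.\<close>

definition ratio_estimator :: "nat \<Rightarrow> nat \<Rightarrow> nat \<Rightarrow> real \<Rightarrow> real" where
  "ratio_estimator r \<gamma> x \<tau> =
    (if \<tau> \<in> {1<..<exp (real \<gamma>)} then ln \<tau> / real \<gamma> else (real x - real r) / real x)"

lemma ratio_estimator_unit_interval:
  assumes "0 < r" "r \<le> x"
  shows "ratio_estimator r \<gamma> x \<tau> \<in> {0..1}"
proof (cases "\<tau> \<in> {1<..<exp (real \<gamma>)}")
  case True
  then have "0 \<le> ln \<tau>" "ln \<tau> \<le> real \<gamma>"
    using ln_less_cancel_iff[of \<tau> "exp (real \<gamma>)"] by auto
  then show ?thesis
    using True by (auto simp: ratio_estimator_def divide_simps)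
qed (use assms in \<open>auto simp: ratio_estimator_def\<close>)

text \<open>The interval is open, so near \<tau> only the logarithmic branch is active; at the
  endpoints the function may jump.\<close>

lemma isCont_ratio_estimator:
  assumes "\<tau> \<in> {1<..<exp (real \<gamma>)}" "\<gamma> > 0"
  shows "isCont (ratio_estimator r \<gamma> x) \<tau>"
proof -
  have "\<forall>\<^sub>F t in nhds \<tau>. t \<in> {1<..<exp (real \<gamma>)}"
    using assms by (intro eventually_nhds_in_open) auto
  then have "\<forall>\<^sub>F t in nhds \<tau>. ratio_estimator r \<gamma> x t = ln t / real \<gamma>"
    by (rule eventually_mono) (simp add: ratio_estimator_def)
  moreover have "isCont (\<lambda>t. ln t / real \<gamma>) \<tau>"
    using assms by (intro continuous_intros) auto
  ultimately show ?thesis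
    by (simp add: isCont_cong)
qed

definition marginal_ratio :: "nat \<Rightarrow> nat \<Rightarrow> nat \<Rightarrow> real \<times> real \<Rightarrow> real" where
  "marginal_ratio r \<gamma> x z = (real r + real \<gamma>) / real r
     * ((real x + real \<gamma>) / real x) powi (int x - int r - 1) * (fst z / snd z)"

lemma isCont_marginal_ratio: "b \<noteq> 0 \<Longrightarrow> isCont (marginal_ratio r \<gamma> x) (a, b)"
  unfolding marginal_ratio_def[abs_def] by (intro continuous_intros) simp

lemma eb_estimator_eq:
  "eb_estimator m r \<gamma> n data x =
     ratio_estimator r \<gamma> x (marginal_ratio r \<gamma> x (m n data x r, m n data (x + \<gamma>) (r + \<gamma>)))"
  by (simp add: eb_estimator_def eb_ratio_def ratio_estimator_def marginal_ratio_def Let_def)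

context bt_prior
begin

text \<open>The factor \<open>K\<close> is the quotient of the coefficients in
  \<open>laplace_term_eq_marginal\<close>, so the shifted marginal is
  \<open>K * laplace_term x\<close> and \<open>K\<close> cancels.\<close>

lemma marginal_ratio_eq:
  assumes x: "r \<le> x"
  shows "marginal_ratio r \<gamma> x (bt_marginal G x r, bt_marginal G (x + \<gamma>) (r + \<gamma>))
       = bt_marginal G x r / laplace_term x"
proof -
  define K where "K = (real r + real \<gamma>) / real r * ((real x + real \<gamma>) / real x) powi (int x - int r - 1)"
  have c: "bt_coeff r x > 0"
    using x r_pos by (intro bt_coeff_pos)
  have "bt_coeff r x * (K * laplace_term x) = bt_coeff r x * bt_marginal G (x + \<gamma>) (r + \<gamma>)"
    using laplace_term_eq_marginal[OF x] bt_coeff_ratio[OF r_pos x, of \<gamma>]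
    unfolding K_def by (simp only: mult.assoc)
  then have *: "K * laplace_term x = bt_marginal G (x + \<gamma>) (r + \<gamma>)"
    using c by (metis mult_left_cancel less_irrefl)
  have "K \<noteq> 0"
    using * bt_marginal_pos[of "r + \<gamma>" "x + \<gamma>"] r_pos x by auto
  then show ?thesis
    unfolding marginal_ratio_def fst_conv snd_conv *[symmetric] K_def[symmetric] by simp
qed

lemma marginal_over_laplace_range:
  assumes x: "r \<le> x"
  shows "bt_marginal G x r / laplace_term x \<in> {1<..<exp (real \<gamma>)}"
  using laplace_term_bounds[OF x] laplace_term_pos[OF x]
  by (simp add: divide_simps exp_minus mult.commute)

lemma bayes_estimator_eq_ratio:
  assumes x: "r \<le> x"
  shows "bayes_estimator G r \<gamma> x = ratio_estimator r \<gamma> x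
    (marginal_ratio r \<gamma> x (bt_marginal G x r, bt_marginal G (x + \<gamma>) (r + \<gamma>)))"
  using marginal_over_laplace_range[OF x]
  by (simp add: marginal_ratio_eq[OF x] bayes_estimator_eq[OF x] ratio_estimator_def)

lemma isCont_risk_term:
  assumes x: "r \<le> x"
  shows "isCont (risk_term x) d"
  unfolding ext[of "risk_term x", OF risk_term_eq[OF x]] by (intro continuous_intros)

lemma bayes_risk_eq: "bayes_risk G r \<gamma> \<delta> = (\<Sum>k. ennreal (risk_term (r + k) (\<delta> (r + k))))"
  by (simp add: bayes_risk_def nn_integral_risk_term)

end

theorem theorem2:
  fixes r \<gamma> :: nat
    and G :: "real measure"
    and M :: "'w measure"
    and ks :: "nat \<Rightarrow> nat list"
    and \<Theta> :: "nat \<Rightarrow> 'w \<Rightarrow> real"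
    and X :: "nat \<Rightarrow> 'w \<Rightarrow> nat list"
    and m :: marginal_estimator
  assumes "r > 0" and "\<gamma> > 0"
    and prior: "prob_space G" "sets G = sets borel" "AE \<theta> in G. \<theta> \<in> {0<..<1}"
    and first_moment: "integrable G (\<lambda>\<theta>. \<theta>)"
    and sample: "bt_sample M G ks \<Theta> X"
    and nonneg: "\<And>n data z y. m n data z y \<ge> 0"
    and consistent:
      "\<And>x. x \<ge> r \<Longrightarrow> consistent_at M X G m x r"
      "\<And>x. x \<ge> r \<Longrightarrow> consistent_at M X G m (x + \<gamma>) (r + \<gamma>)"
  shows "(\<lambda>n. eb_risk M X G r \<gamma> (eb_estimator m r \<gamma>) n)
           \<longlonglongrightarrow> bayes_risk G r \<gamma> (bayes_estimator G r \<gamma>)"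
proof -
  interpret S: bt_sample M G ks \<Theta> X by (rule sample)
  interpret P: bt_prior G r \<gamma>
    using assms(1,2) prior by (simp add: bt_prior_def bt_prior_axioms_def)
  let ?risk = "\<lambda>n k \<omega>. P.risk_term (r + k) (eb_estimator m r \<gamma> n (past_data X n \<omega>) (r + k))"
  let ?bayes = "\<lambda>k. P.risk_term (r + k) (bayes_estimator G r \<gamma> (r + k))"
  let ?bound = "\<lambda>k. (exp (real \<gamma>) + 2 * real \<gamma>) * bt_bound r k"
  have data [measurable]: "(\<lambda>\<omega>. f (past_data X n \<omega>)) \<in> borel_measurable M"
    for n and f :: "nat list list \<Rightarrow> real"
    by (rule measurable_compose[OF S.measurable_past_data]) simp
  have bound: "0 \<le> ?risk n k \<omega>" "?risk n k \<omega> \<le> ?bound k" for n k \<omega>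
    unfolding eb_estimator_eq using \<open>r > 0\<close>
    by (auto intro!: P.risk_term_nonneg P.risk_term_le ratio_estimator_unit_interval)
  have int: "integrable M (?risk n k)" for n k
    by (rule S.integrable_const_bound[of _ "?bound k"]) (use bound data in auto)
  have lim: "(\<lambda>n. S.expectation (?risk n k)) \<longlonglongrightarrow> ?bayes k" for k
  proof (rule S.expectation_tendsto_if_tendsto_in_probability)
    let ?x = "r + k"
    let ?h = "\<lambda>z. P.risk_term ?x (ratio_estimator r \<gamma> ?x (marginal_ratio r \<gamma> ?x z))"
    let ?z = "(bt_marginal G ?x r, bt_marginal G (?x + \<gamma>) (r + \<gamma>))"
    \<comment> \<open>At the true marginals the denominator is positive and the ratio is interior to
      (1, e^\<gamma>), so all three maps in the composition are continuous there.\<close>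
    have "isCont ?h ?z"
      using P.marginal_over_laplace_range[of ?x] P.bt_marginal_pos[of "r + \<gamma>" "?x + \<gamma>"] assms(1,2)
      by (intro isCont_o2[OF _ P.isCont_risk_term] isCont_o2[OF _ isCont_ratio_estimator]
          isCont_marginal_ratio) (auto simp: P.marginal_ratio_eq)
    then have "tendsto_in_probability M (\<lambda>n \<omega>. ?h (m n (past_data X n \<omega>) ?x r,
        m n (past_data X n \<omega>) (?x + \<gamma>) (r + \<gamma>))) (?h ?z)"
      using consistent[of ?x] unfolding consistent_at_def
      by (intro S.tendsto_in_probability_isCont_pair data) auto
    then show "tendsto_in_probability M (\<lambda>n. ?risk n k) (?bayes k)"
      by (simp add: eb_estimator_eq P.bayes_estimator_eq_ratio)
    show "\<bar>?risk n k \<omega>\<bar> \<le> ?bound k" for n \<omega>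
      using bound[of k n \<omega>] by simp
  qed (rule data)
  have exp_bound: "0 \<le> S.expectation (?risk n k)" "S.expectation (?risk n k) \<le> ?bound k" for n k
    using bound int by (auto intro!: integral_nonneg S.integral_le_const)
  have summable: "summable ?bound"
    by (intro summable_mult summable_bt_bound assms(1))
  \<comment> \<open>The Bayes terms inherit the bounds as limits of expectations that satisfy
    them.\<close>
  have bayes_bound: "0 \<le> ?bayes k" "?bayes k \<le> ?bound k" for k
    using lim[of k] exp_bound by (auto intro: LIMSEQ_le_const LIMSEQ_le_const2)
  have "(\<lambda>n. \<Sum>k. S.expectation (?risk n k)) \<longlonglongrightarrow> (\<Sum>k. ?bayes k)"
    using tannerys_theorem[OF lim _ summable] exp_bound
    by (simp add: eventually_True case_prod_unfold)
  then have "(\<lambda>n. ennreal (\<Sum>k. S.expectation (?risk n k))) \<longlonglongrightarrow> ennreal (\<Sum>k. ?bayes k)"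
    by (rule tendsto_ennrealI)
  moreover have "eb_risk M X G r \<gamma> (eb_estimator m r \<gamma>) n
      = ennreal (\<Sum>k. S.expectation (?risk n k))" for n
  proof -
    have "eb_risk M X G r \<gamma> (eb_estimator m r \<gamma>) n = (\<integral>\<^sup>+\<omega>. (\<Sum>k. ennreal (?risk n k \<omega>)) \<partial>M)"
      by (simp add: eb_risk_def P.bayes_risk_eq)
    \<comment> \<open>Nonnegative terms allow expectation and series to be exchanged in
      [0, \<infinity>]; the summable majorant then turns the result into a real series, to which the
      limit above applies.\<close>
    also have "\<dots> = (\<Sum>k. \<integral>\<^sup>+\<omega>. ennreal (?risk n k \<omega>) \<partial>M)"
      by (rule nn_integral_suminf) (rule measurable_compose[OF data measurable_ennreal])
    also have "\<dots> = (\<Sum>k. ennreal (S.expectation (?risk n k)))"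
      using bound by (subst nn_integral_eq_integral[OF int]) auto
    also have "\<dots> = ennreal (\<Sum>k. S.expectation (?risk n k))"
      using exp_bound by (intro suminf_ennreal2 summable_comparison_test'[OF summable]) auto
    finally show ?thesis .
  qed
  moreover have "bayes_risk G r \<gamma> (bayes_estimator G r \<gamma>) = ennreal (\<Sum>k. ?bayes k)"
    unfolding P.bayes_risk_eq using bayes_bound
    by (intro suminf_ennreal2 summable_comparison_test'[OF summable]) auto
  ultimately show ?thesis by simp
qed

end
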